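(* Let $G$ and $H$ be two nontrivial traceable graphs with $|V(G)|=n$ and $|V(H)|=m$. Then $tpc(G\square H)=3$.
   Context: All graphs are simple, finite and undirected. A graph is traceable if it has a Hamiltonian path (a path containing every vertex). A graph is total-colored if all its vertices and edges are assigned colors. A path in a total-colored graph is a total proper path if (i) any two adjacent edges on the path differ in color, (ii) any two adjacent internal vertices of the path differ in color, and (iii) every internal vertex of the path differs in color from the edges of the path incident with it. A total-colored graph is total-proper connected if any two vertices are joined by a total proper path. For a connected graph $G$, $tpc(G)$ is the smallest number of colors in a total-coloring making $G$ total-proper connected. The Cartesian product $G\square H$ has vertex set $V(G)\times V(H)$, with $(g,h)$ adjacent to $(g',h')$ iff either $g=g'$ and $hh'\in E(H)$, or $h=h'$ and $gg'\in E(G)$. *)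

theory Defs
  imports Main
begin

record 'a ugraph =
  verts :: "'a set"
  edges :: "'a set set"

definition simple_graph :: "'a ugraph \<Rightarrow> bool" where
  "simple_graph G \<longleftrightarrow> finite (verts G) \<and> (\<forall>e\<in>edges G. e \<subseteq> verts G \<and> card e = 2)"

text \<open>A path is the list of its vertices, without repetitions.\<close>

definition is_path :: "'a ugraph \<Rightarrow> 'a list \<Rightarrow> bool" where
  "is_path G p \<longleftrightarrow> p \<noteq> [] \<and> set p \<subseteq> verts G \<and> distinct p \<and>
     (\<forall>i. Suc i < length p \<longrightarrow> {p ! i, p ! Suc i} \<in> edges G)"

definition traceable :: "'a ugraph \<Rightarrow> bool" where
  "traceable G \<longleftrightarrow> (\<exists>p. is_path G p \<and> set p = verts G)"

definition cartesian_product :: "'a ugraph \<Rightarrow> 'b ugraph \<Rightarrow> ('a \<times> 'b) ugraph" (infixl "\<box>" 70) where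
  "G \<box> H = \<lparr> verts = verts G \<times> verts H,
     edges = {{(g, h), (g', h')} | g h g' h'.
       (g, h) \<in> verts G \<times> verts H \<and> (g', h') \<in> verts G \<times> verts H \<and>
       (g = g' \<and> {h, h'} \<in> edges H \<or> h = h' \<and> {g, g'} \<in> edges G)} \<rparr>"

lemma simple_graph_cartesian_product:
  assumes "simple_graph G" "simple_graph H"
  shows "simple_graph (G \<box> H)"
  using assms
  by (fastforce simp: simple_graph_def cartesian_product_def card_2_iff doubleton_eq_iff)

text \<open>
  A total-coloring consists of a vertex coloring \<open>cv\<close> and an edge coloring \<open>ce\<close> sharing one
  set of colors; it is arbitrary, not required to be proper. Only the values on the vertices
  and edges of the graph matter.

  The internal vertices of a path \<open>p\<close> are the \<open>p ! i\<close> with \<open>0 < i\<close> and \<open>Suc i < length p\<close>.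
  In the second condition adjacency means adjacency along the path.
\<close>

definition total_proper_path ::
    "'a ugraph \<Rightarrow> ('a \<Rightarrow> nat) \<Rightarrow> ('a set \<Rightarrow> nat) \<Rightarrow> 'a list \<Rightarrow> bool" where
  "total_proper_path G cv ce p \<longleftrightarrow> is_path G p \<and>
     (\<forall>i. Suc (Suc i) < length p \<longrightarrow>
        ce {p ! i, p ! Suc i} \<noteq> ce {p ! Suc i, p ! Suc (Suc i)}) \<and>
     (\<forall>i. 0 < i \<and> Suc (Suc i) < length p \<longrightarrow> cv (p ! i) \<noteq> cv (p ! Suc i)) \<and>
     (\<forall>i. 0 < i \<and> Suc i < length p \<longrightarrow>
        cv (p ! i) \<noteq> ce {p ! (i - 1), p ! i} \<and> cv (p ! i) \<noteq> ce {p ! i, p ! Suc i})"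

definition total_proper_connected ::
    "'a ugraph \<Rightarrow> ('a \<Rightarrow> nat) \<Rightarrow> ('a set \<Rightarrow> nat) \<Rightarrow> bool" where
  "total_proper_connected G cv ce \<longleftrightarrow>
     (\<forall>u\<in>verts G. \<forall>v\<in>verts G. u \<noteq> v \<longrightarrow>
        (\<exists>p. total_proper_path G cv ce p \<and> hd p = u \<and> last p = v))"

text \<open>Meaningful for connected graphs only; otherwise no \<open>k\<close> satisfies the condition.\<close>

definition tpc :: "'a ugraph \<Rightarrow> nat" where
  "tpc G = (LEAST k. \<exists>cv ce. card (cv ` verts G \<union> ce ` edges G) = k \<and>
     total_proper_connected G cv ce)"

end

theory Submission
  imports Defs
begin

text \<open>
  Color the vertices and edges of a Hamiltonian path alternately and cyclically with three colors.
  Every segment of it is then a total proper path, so a traceable graph needs at most three colors.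
  Two nonadjacent vertices force an internal vertex whose color and the colors of its two path edges
  are distinct, so three colors are needed. The product of two traceable graphs is traversed by a
  snake, row by row in alternating directions.
\<close>

section \<open>Paths and traceability of the product\<close>

lemma is_path_iff_successively:
  "is_path G p \<longleftrightarrow> p \<noteq> [] \<and> set p \<subseteq> verts G \<and> distinct p \<and>
     successively (\<lambda>x y. {x, y} \<in> edges G) p"
  by (simp add: is_path_def successively_conv_nth)

lemma is_path_append:
  assumes "is_path G p" "is_path G q" "set p \<inter> set q = {}" "{last p, hd q} \<in> edges G"
  shows "is_path G (p @ q)"
  using assms by (auto simp: is_path_iff_successively successively_append_iff)

lemma is_path_rev: "is_path G p \<Longrightarrow> is_path G (rev p)"
  by (simp add: is_path_iff_successively insert_commute)

lemma is_path_cartesian_productI: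
  assumes "is_path H ys" "x \<in> verts G"
  shows "is_path (G \<box> H) (map (Pair x) ys)"
proof -
  have "{(x, ys ! i), (x, ys ! Suc i)} \<in> edges (G \<box> H)" if "Suc i < length ys" for i
  proof -
    have "ys ! i \<in> verts H" "ys ! Suc i \<in> verts H" "{ys ! i, ys ! Suc i} \<in> edges H"
      using assms that by (auto simp: is_path_def)
    with assms(2) show ?thesis
      unfolding cartesian_product_def by auto
  qed
  with assms show ?thesis
    by (auto simp: is_path_def distinct_map inj_on_def cartesian_product_def)
qed

text \<open>Induction on \<open>xs\<close>, one row for each of its vertices. The head of
  \<open>q\<close> is prescribed so that rows can be glued, and \<open>ys\<close> stays arbitrary
  because the next row runs through it backwards: it starts in column \<open>last ys\<close>, where
  the current row ends.\<close>

lemma path_cartesian_product: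
  assumes "is_path G xs" "is_path H ys"
  shows "\<exists>q. is_path (G \<box> H) q \<and> set q = set xs \<times> set ys \<and> hd q = (hd xs, hd ys)"
  using assms
proof (induction xs arbitrary: ys)
  case Nil
  then show ?case by (simp add: is_path_def)
next
  case (Cons x xs)
  let ?row = "map (Pair x) ys"
  have ys: "ys \<noteq> []" "set ys \<subseteq> verts H" and x: "x \<in> verts G" "x \<notin> set xs"
    using Cons.prems by (auto simp: is_path_def)
  have row: "is_path (G \<box> H) ?row"
    using Cons.prems x by (intro is_path_cartesian_productI)
  show ?case
  proof (cases "xs = []")
    case True
    with row ys show ?thesis by (intro exI[of _ ?row]) (auto simp: hd_map)
  next
    case False
    have xs: "is_path G xs" and step: "{x, hd xs} \<in> edges G"
      using Cons.prems False by (auto simp: is_path_iff_successively successively_Cons)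
    obtain q where q: "is_path (G \<box> H) q" "set q = set xs \<times> set ys" "hd q = (hd xs, last ys)"
      using Cons.IH[OF xs is_path_rev[OF Cons.prems(2)]] by (auto simp: hd_rev)
    have "hd xs \<in> verts G" "last ys \<in> verts H"
      using xs ys False by (auto simp: is_path_def)
    then have "{last ?row, hd q} \<in> edges (G \<box> H)"
      using q(3) ys x step by (auto simp: last_map cartesian_product_def)
    then have "is_path (G \<box> H) (?row @ q)"
      using row q x by (intro is_path_append) auto
    moreover have "set (?row @ q) = set (x # xs) \<times> set ys"
      using q(2) by auto
    moreover have "hd (?row @ q) = (hd (x # xs), hd ys)"
      using ys by (simp add: hd_map)
    ultimately show ?thesis by blast
  qed
qed

lemma traceable_cartesian_product:
  assumes "traceable G" "traceable H"
  shows "traceable (G \<box> H)"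
proof -
  obtain p q where "is_path G p" "set p = verts G" "is_path H q" "set q = verts H"
    using assms by (auto simp: traceable_def)
  with path_cartesian_product[of G p H q] show ?thesis
    by (auto simp: traceable_def cartesian_product_def)
qed

section \<open>Reversal and segments of total proper paths\<close>

lemma total_proper_path_rev:
  assumes "total_proper_path G cv ce p"
  shows "total_proper_path G cv ce (rev p)"
proof -
  let ?n = "length p"
  have edge: "ce {p ! i, p ! Suc i} \<noteq> ce {p ! Suc i, p ! Suc (Suc i)}"
    if "Suc (Suc i) < ?n" for i
    using assms that by (simp add: total_proper_path_def)
  have vert: "cv (p ! i) \<noteq> cv (p ! Suc i)" if "0 < i" "Suc (Suc i) < ?n" for i
    using assms that by (simp add: total_proper_path_def)
  have inc: "cv (p ! i) \<noteq> ce {p ! (i - 1), p ! i}" "cv (p ! i) \<noteq> ce {p ! i, p ! Suc i}"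
    if "0 < i" "Suc i < ?n" for i
    using assms that by (simp_all add: total_proper_path_def)
  show ?thesis
    unfolding total_proper_path_def
  proof (intro conjI allI impI)
    show "is_path G (rev p)"
      using assms by (simp add: total_proper_path_def is_path_rev)
  next
    fix i assume i: "Suc (Suc i) < length (rev p)"
    \<comment> \<open>The least of the mirrored positions: entries \<open>i\<close>,
      \<open>i + 1\<close>, \<open>i + 2\<close> of \<open>rev p\<close> are entries
      \<open>j + 2\<close>, \<open>j + 1\<close>, \<open>j\<close> of \<open>p\<close>.\<close>
    define j where "j = ?n - Suc (Suc (Suc i))"
    have "?n - Suc i = Suc (Suc j)" "?n - Suc (Suc i) = Suc j" "Suc (Suc j) < ?n"
      using i by (auto simp: j_def)
    with edge[of j, symmetric] i
    show "ce {rev p ! i, rev p ! Suc i} \<noteq> ce {rev p ! Suc i, rev p ! Suc (Suc i)}"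
      by (simp add: rev_nth insert_commute j_def[symmetric])
  next
    fix i assume i: "0 < i \<and> Suc (Suc i) < length (rev p)"
    define j where "j = ?n - Suc (Suc i)"
    have "?n - Suc i = Suc j" "0 < j" "Suc (Suc j) < ?n"
      using i by (auto simp: j_def)
    with vert[of j] i show "cv (rev p ! i) \<noteq> cv (rev p ! Suc i)"
      by (simp add: rev_nth j_def[symmetric])
  next
    fix i assume i: "0 < i \<and> Suc i < length (rev p)"
    \<comment> \<open>Here \<open>j\<close> mirrors \<open>i\<close> itself. Reversal swaps the two
      path edges at this vertex, so each goal comes from the other half of
      \<open>inc\<close>.\<close>
    define j where "j = ?n - Suc i"
    have j: "?n - i = Suc j" "?n - Suc (Suc i) = j - 1" "0 < j" "Suc j < ?n"
      using i by (auto simp: j_def)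
    then show "cv (rev p ! i) \<noteq> ce {rev p ! (i - 1), rev p ! i}"
      and "cv (rev p ! i) \<noteq> ce {rev p ! i, rev p ! Suc i}"
      using inc[of j] i by (simp_all add: rev_nth insert_commute j_def[symmetric])
  qed
qed

lemma total_proper_path_take:
  assumes "total_proper_path G cv ce p" "0 < k"
  shows "total_proper_path G cv ce (take k p)"
  using assms by (auto simp: total_proper_path_def is_path_def dest: in_set_takeD)

text \<open>A suffix is the reversal of a prefix of the reversed path, which avoids shifting indices
  in all the conditions.\<close>

lemma total_proper_path_drop:
  assumes "total_proper_path G cv ce p" "k < length p"
  shows "total_proper_path G cv ce (drop k p)"
  using total_proper_path_rev[OF total_proper_path_take[OF total_proper_path_rev[OF assms(1)],
      of "length p - k"]] assms(2)
  by (simp add: take_rev)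

section \<open>Three colors suffice for a traceable graph\<close>

lemma total_proper_connected_if_hamiltonian:
  assumes p: "total_proper_path G cv ce p" "set p = verts G"
  shows "total_proper_connected G cv ce"
proof -
  have *: "\<exists>q. total_proper_path G cv ce q \<and> hd q = p ! i \<and> last q = p ! j"
    if "i < j" "j < length p" for i j
  proof (intro exI conjI)
    let ?q = "drop i (take (Suc j) p)"
    show "total_proper_path G cv ce ?q"
      using that p by (intro total_proper_path_drop total_proper_path_take) auto
    show "hd ?q = p ! i" "last ?q = p ! j"
      using that by (simp_all add: hd_drop_conv_nth last_conv_nth)
  qed
  show ?thesis
    unfolding total_proper_connected_def
  proof (intro ballI impI)
    fix u v assume "u \<in> verts G" "v \<in> verts G" "u \<noteq> v"
    then obtain i j where ij: "i < length p" "j < length p" "u = p ! i" "v = p ! j" "i \<noteq> j"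
      unfolding p(2)[symmetric] in_set_conv_nth by blast
    show "\<exists>q. total_proper_path G cv ce q \<and> hd q = u \<and> last q = v"
    proof (cases "i < j")
      case True
      with * ij show ?thesis by blast
    next
      case False
      then obtain q where q: "total_proper_path G cv ce q" "hd q = v" "last q = u"
        using *[of j i] ij by auto
      then have "q \<noteq> []" by (simp add: total_proper_path_def is_path_def)
      with q total_proper_path_rev[OF q(1)] show ?thesis
        by (intro exI[of _ "rev q"]) (simp add: hd_rev last_rev)
    qed
  qed
qed

text \<open>Vertex \<open>i\<close> of the path gets \<open>i mod 3\<close> and the edge after it
  \<open>(i + 2) mod 3\<close>, so vertices and edges in turn read 0, 2, 1, 0, 2, 1, and so on. Any
  three consecutive terms are distinct, which covers all three conditions on a total proper
  path.\<close>

lemma traceable_three_coloring: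
  assumes "traceable G"
  obtains cv ce where "total_proper_connected G cv ce" "\<And>x. cv x < 3" "\<And>e. ce e < 3"
proof -
  obtain p where p: "is_path G p" "set p = verts G"
    using assms by (auto simp: traceable_def)
  have dist: "distinct p" using p by (simp add: is_path_def)
  \<comment> \<open>\<open>inv_into\<close> recovers the position of \<open>x\<close> on
    \<open>p\<close>; reducing mod 3 also bounds the unspecified values off the path.\<close>
  define cv where "cv x = inv_into {..<length p} ((!) p) x mod 3" for x
  \<comment> \<open>If the endpoints have distinct colors in \<open>{0, 1, 2}\<close>, the edge gets the third one.\<close>
  define ce where "ce e = 2 * sum cv e mod 3" for e
  have cv: "cv (p ! i) = i mod 3" if "i < length p" for i
    using that dist by (simp add: cv_def inv_into_f_f inj_on_nth)
  have ce: "ce {p ! i, p ! Suc i} = (i + 2) mod 3" if "Suc i < length p" for i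
  proof -
    \<comment> \<open>Distinct endpoints give the sum over the edge two terms, and 2(2i + 1) = 4i +
      2 is congruent to i + 2 mod 3.\<close>
    have "p ! i \<noteq> p ! Suc i"
      using that dist by (simp add: nth_eq_iff_index_eq)
    then have "ce {p ! i, p ! Suc i} = 2 * (i mod 3 + Suc i mod 3) mod 3"
      using that by (simp add: ce_def cv)
    also have "\<dots> = (2 * (i + Suc i)) mod 3"
      by (metis mod_add_eq mod_mult_right_eq)
    also have "\<dots> = (i + 2) mod 3" by presburger
    finally show ?thesis .
  qed
  have "total_proper_path G cv ce p"
    unfolding total_proper_path_def
  proof (intro conjI allI impI)
    show "is_path G p" by fact
  next
    fix i assume "Suc (Suc i) < length p"
    then have "ce {p ! i, p ! Suc i} = (i + 2) mod 3"
      "ce {p ! Suc i, p ! Suc (Suc i)} = (Suc i + 2) mod 3"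
      by (simp_all only: ce Suc_lessD)
    then show "ce {p ! i, p ! Suc i} \<noteq> ce {p ! Suc i, p ! Suc (Suc i)}" by presburger
  next
    fix i assume "0 < i \<and> Suc (Suc i) < length p"
    then have "cv (p ! i) = i mod 3" "cv (p ! Suc i) = Suc i mod 3"
      by (simp_all add: cv)
    then show "cv (p ! i) \<noteq> cv (p ! Suc i)" by presburger
  next
    fix i assume i: "0 < i \<and> Suc i < length p"
    then have "cv (p ! i) = i mod 3" "ce {p ! i, p ! Suc i} = (i + 2) mod 3"
      by (simp_all only: cv ce Suc_lessD)
    then show "cv (p ! i) \<noteq> ce {p ! i, p ! Suc i}" by presburger
    obtain j where j: "i = Suc j" using i by (cases i) auto
    have "cv (p ! i) = Suc j mod 3" "ce {p ! (i - 1), p ! i} = (j + 2) mod 3"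
      using i j ce[of j] by (simp_all add: cv)
    then show "cv (p ! i) \<noteq> ce {p ! (i - 1), p ! i}" by presburger
  qed
  then have "total_proper_connected G cv ce"
    using p(2) by (rule total_proper_connected_if_hamiltonian)
  then show ?thesis
    by (rule that) (simp_all add: cv_def ce_def)
qed

section \<open>A nonadjacent pair forces three colors\<close>

lemma finite_edges:
  assumes "simple_graph G"
  shows "finite (edges G)"
  by (rule finite_subset[of _ "Pow (verts G)"]) (use assms in \<open>auto simp: simple_graph_def\<close>)

lemma three_colors_if_nonadjacent:
  assumes "simple_graph G" "total_proper_connected G cv ce"
    and uv: "u \<in> verts G" "v \<in> verts G" "u \<noteq> v" "{u, v} \<notin> edges G"
  shows "3 \<le> card (cv ` verts G \<union> ce ` edges G)"
proof -
  obtain p where p: "total_proper_path G cv ce p" "hd p = u" "last p = v"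
    using assms by (auto simp: total_proper_connected_def)
  then have path: "is_path G p" by (simp add: total_proper_path_def)
  \<comment> \<open>A path with one vertex would give \<open>u = v\<close>, and one with two would
    make \<open>{u, v}\<close> an edge. Hence \<open>p ! 1\<close> is internal.\<close>
  have "Suc (Suc 0) < length p"
  proof (rule ccontr)
    assume "\<not> ?thesis"
    moreover have "p \<noteq> []" using path by (simp add: is_path_def)
    ultimately have "length p = 1 \<or> length p = 2"
      by (simp flip: length_greater_0_conv) linarith
    then show False
      using p path uv(3,4) by (auto simp: length_Suc_conv is_path_def numeral_2_eq_2)
  qed
  then have "ce {p ! 0, p ! 1} \<noteq> ce {p ! 1, p ! 2}"
    "cv (p ! 1) \<noteq> ce {p ! 0, p ! 1}" "cv (p ! 1) \<noteq> ce {p ! 1, p ! 2}"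
    "{p ! 0, p ! 1} \<in> edges G" "{p ! 1, p ! 2} \<in> edges G" "p ! 1 \<in> verts G"
    using p(1) path by (auto simp: total_proper_path_def is_path_def numeral_2_eq_2)
  then have "card {cv (p ! 1), ce {p ! 0, p ! 1}, ce {p ! 1, p ! 2}} = 3"
    and "{cv (p ! 1), ce {p ! 0, p ! 1}, ce {p ! 1, p ! 2}} \<subseteq> cv ` verts G \<union> ce ` edges G"
    by auto
  \<comment> \<open>\<open>card\<close> is 0 on infinite sets, so monotonicity needs
    finiteness.\<close>
  moreover have "finite (cv ` verts G \<union> ce ` edges G)"
    using assms(1) finite_edges by (auto simp: simple_graph_def)
  ultimately show ?thesis by (metis card_mono)
qed

text \<open>The product structure enters only through traceability and a nonadjacent pair, so the
  value is computed for any graph with both.\<close>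

theorem tpc_traceable:
  assumes "simple_graph G" "traceable G"
    and "u \<in> verts G" "v \<in> verts G" "u \<noteq> v" "{u, v} \<notin> edges G"
  shows "tpc G = 3"
  unfolding tpc_def
proof (rule Least_equality)
  obtain cv ce where c: "total_proper_connected G cv ce" "\<And>x. cv x < 3" "\<And>e. ce e < 3"
    using traceable_three_coloring[OF assms(2)] by blast
  \<comment> \<open>\<open>tpc\<close> counts the colors actually used; the lower bound applied to
    this same coloring shows that all three occur.\<close>
  have "card (cv ` verts G \<union> ce ` edges G) \<le> card {..<3::nat}"
    using c by (intro card_mono) auto
  then have "card (cv ` verts G \<union> ce ` edges G) = 3"
    using three_colors_if_nonadjacent[OF assms(1) c(1) assms(3-6)] by simp
  with c(1) show "\<exists>cv ce. card (cv ` verts G \<union> ce ` edges G) = 3 \<and> total_proper_connected G cv ce"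
    by blast
qed (use three_colors_if_nonadjacent[OF assms(1) _ assms(3-6)] in blast)

theorem theorem3p1:
  fixes G :: "'a ugraph" and H :: "'b ugraph" and n m :: nat
  assumes "simple_graph G" and "simple_graph H"
    and "traceable G" and "traceable H"
    and "card (verts G) = n" and "card (verts H) = m"
    and "n \<ge> 2" and "m \<ge> 2"
  shows "tpc (G \<box> H) = 3"
proof -
  obtain g g' where g: "g \<in> verts G" "g' \<in> verts G" "g \<noteq> g'"
    using assms(5,7) card_le_Suc0_iff_eq[of "verts G"] assms(1)
    by (fastforce simp: simple_graph_def)
  obtain h h' where h: "h \<in> verts H" "h' \<in> verts H" "h \<noteq> h'"
    using assms(6,8) card_le_Suc0_iff_eq[of "verts H"] assms(2)
    by (fastforce simp: simple_graph_def)
  show ?thesis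
  proof (rule tpc_traceable)
    show "simple_graph (G \<box> H)" "traceable (G \<box> H)"
      using assms by (simp_all add: simple_graph_cartesian_product traceable_cartesian_product)
    \<comment> \<open>The two vertices differ in both coordinates, hence are nonadjacent whatever
      the edges of \<open>G\<close> and \<open>H\<close>.\<close>
    show "(g, h) \<in> verts (G \<box> H)" "(g', h') \<in> verts (G \<box> H)" "(g, h) \<noteq> (g', h')"
      using g h by (simp_all add: cartesian_product_def)
    show "{(g, h), (g', h')} \<notin> edges (G \<box> H)"
      using g h by (auto simp: cartesian_product_def doubleton_eq_iff)
  qed
qed

end
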